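(* If $G$ is an interval $k$-graph with maximum degree $\Delta$ and multiplicity $\mu$, then $$\lambda_{2,1}(G)\le\max\{4\Delta-2,\ \Delta+3\mu-1\}\le 4\Delta-1.$$
   Context: All graphs are simple. For a graph $G=(V,E)$: $N_G(v)$ is the set of neighbors of $v$; $\Delta$ is the maximum degree; $d_G(u,v)$ is the length of a shortest path between $u$ and $v$; the multiplicity is $\mu=\max\{|N_G(u)\cap N_G(v)|: u,v\in V,\ u\ne v\}$. An $L(2,1)$-labeling of $G$ is a function $f:V\to\{0,1,2,\dots\}$ with $|f(u)-f(v)|\ge 2$ whenever $uv\in E$ and $|f(u)-f(v)|\ge 1$ whenever $d_G(u,v)=2$. Its span is the difference between the largest and the smallest label used. $\lambda_{2,1}(G)$ is the least integer $k$ such that $G$ has an $L(2,1)$-labeling with span $k$. $G$ is an interval $k$-graph if each vertex $v$ can be assigned a pair $(I_v,\kappa(v))$, with $I_v$ a closed interval of the real line and $\kappa(v)\in\{1,\dots,k\}$, so that $uv\in E$ iff $I_u\cap I_v\neq\emptyset$ and $\kappa(u)\ne\kappa(v)$.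
   Formalization: For edgeless graphs (Δ = 0) the printed bound is false (λ = 0 but the maximum is −1); the formal statement replaces negative values of 4Δ−2, Δ+3μ−1 and 4Δ−1 by 0, which changes nothing when Δ ≥ 1. *)

theory Defs
  imports "Graph_Theory.Shortest_Path"
begin

text \<open>
  Finite simple graphs are the structures \<open>G\<close> satisfying the locale predicate \<open>graph\<close>: every
  undirected edge \<open>uv\<close> is represented by the two arcs \<open>(u, v)\<close> and \<open>(v, u)\<close>. In particular
  \<open>out_degree G v\<close> is the number of neighbours of \<open>v\<close>.
\<close>

definition neighbors :: "('a, 'b) pre_digraph \<Rightarrow> 'a \<Rightarrow> 'a set" where
  "neighbors G v = {u. v \<rightarrow>\<^bsub>G\<^esub> u}"

definition max_degree :: "('a, 'b) pre_digraph \<Rightarrow> nat" where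
  "max_degree G = Max (out_degree G ` verts G)"

text \<open>The inserted 0 only matters for a graph with one vertex, which has no pair of distinct vertices.\<close>

definition multiplicity :: "('a, 'b) pre_digraph \<Rightarrow> nat" where
  "multiplicity G = Max (insert 0 {card (neighbors G u \<inter> neighbors G v) | u v.
     u \<in> verts G \<and> v \<in> verts G \<and> u \<noteq> v})"

text \<open>Every arc has weight 1, so the distance is the least number of edges of a walk, and it is
  infinite if there is none.\<close>

definition graph_dist :: "('a, 'b) pre_digraph \<Rightarrow> 'a \<Rightarrow> 'a \<Rightarrow> ereal" where
  "graph_dist G u v = wf_digraph.\<mu> G (\<lambda>_. 1) u v"

definition L21_labeling :: "('a, 'b) pre_digraph \<Rightarrow> ('a \<Rightarrow> nat) \<Rightarrow> bool" where
  "L21_labeling G f \<longleftrightarrow> (\<forall>u \<in> verts G. \<forall>v \<in> verts G.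
     (u \<rightarrow>\<^bsub>G\<^esub> v \<longrightarrow> \<bar>int (f u) - int (f v)\<bar> \<ge> 2) \<and>
     (graph_dist G u v = 2 \<longrightarrow> \<bar>int (f u) - int (f v)\<bar> \<ge> 1))"

definition label_span :: "('a, 'b) pre_digraph \<Rightarrow> ('a \<Rightarrow> nat) \<Rightarrow> nat" where
  "label_span G f = Max (f ` verts G) - Min (f ` verts G)"

definition lambda21 :: "('a, 'b) pre_digraph \<Rightarrow> nat" where
  "lambda21 G = (LEAST k. \<exists>f. L21_labeling G f \<and> label_span G f = k)"

definition interval_k_graph :: "nat \<Rightarrow> ('a, 'b) pre_digraph \<Rightarrow> bool" where
  "interval_k_graph k G \<longleftrightarrow> (\<exists>(I :: 'a \<Rightarrow> real set) (\<kappa> :: 'a \<Rightarrow> nat).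
     (\<forall>v \<in> verts G. (\<exists>a b. a \<le> b \<and> I v = {a..b}) \<and> \<kappa> v \<in> {1..k}) \<and>
     (\<forall>u \<in> verts G. \<forall>v \<in> verts G. u \<rightarrow>\<^bsub>G\<^esub> v \<longleftrightarrow> I u \<inter> I v \<noteq> {} \<and> \<kappa> u \<noteq> \<kappa> v))"

end

theory Submission
  imports Defs
begin

text \<open>
  In a set \<open>X\<close> of vertices let \<open>v\<close> have the rightmost left endpoint \<open>x\<close>. Its neighbours in \<open>X\<close>
  contain \<open>x\<close>, and a vertex at distance two that avoids \<open>x\<close> lies to the left of \<open>x\<close>. All these
  vertices are dominated by the neighbour of \<open>v\<close> that starts first, together with the neighbour of
  another colour that starts first. Hence \<open>v\<close> can be labelled greedily after \<open>X - {v}\<close>, except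
  when \<open>v\<close> has maximum degree, its neighbours all have one colour, and no other vertex has the
  same neighbours. In that case the neighbour of \<open>v\<close> that starts last is a leaf in \<open>X\<close>, and this
  leaf can be labelled greedily instead. For \<open>\<Delta> = 1\<close> greedy counting loses one label, but the labels 0
  and 2, distributed along each edge by colour, suffice.
\<close>

section \<open>Greedy labelling\<close>

text \<open>Label all vertices but \<open>u\<close> by induction, then \<open>u\<close>: each
  neighbour blocks at most 3 of the \<open>B + 1\<close> labels, each other \<open>near\<close>
  vertex at most 1. As \<open>near\<close> does not depend on \<open>X\<close>, deleting
  \<open>u\<close> loses no constraint between the remaining vertices.\<close>

lemma greedy_labelling:
  fixes adj near :: "'a \<Rightarrow> 'a \<Rightarrow> bool" and B :: nat
  assumes "finite V"
    and symm: "\<And>u v. adj u v \<Longrightarrow> adj v u" "\<And>u v. near u v \<Longrightarrow> near v u"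
    and irrefl: "\<And>u. \<not> adj u u"
    and pick: "\<And>X. X \<subseteq> V \<Longrightarrow> X \<noteq> {} \<Longrightarrow> \<exists>u\<in>X.
      3 * card {w\<in>X. adj u w} + card {w\<in>X. w \<noteq> u \<and> \<not> adj u w \<and> near u w} \<le> B"
  shows "\<exists>f. (\<forall>u\<in>V. f u \<le> B) \<and> (\<forall>u\<in>V. \<forall>w\<in>V.
    (adj u w \<longrightarrow> f u + 2 \<le> f w \<or> f w + 2 \<le> f u) \<and> (u \<noteq> w \<and> near u w \<longrightarrow> f u \<noteq> f w))"
proof -
  define good where "good X f \<longleftrightarrow> (\<forall>u\<in>X. f u \<le> B) \<and> (\<forall>u\<in>X. \<forall>w\<in>X.
    (adj u w \<longrightarrow> f u + 2 \<le> f w \<or> f w + 2 \<le> f u) \<and> (u \<noteq> w \<and> near u w \<longrightarrow> f u \<noteq> f w))"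
    for X and f :: "'a \<Rightarrow> nat"
  have "\<exists>f. good X f" if "X \<subseteq> V" for X
    using finite_subset[OF that \<open>finite V\<close>] that
  proof (induction X rule: finite_remove_induct)
    case empty
    show ?case by (simp add: good_def)
  next
    case (remove X)
    obtain u where u: "u \<in> X" and le:
      "3 * card {w\<in>X. adj u w} + card {w\<in>X. w \<noteq> u \<and> \<not> adj u w \<and> near u w} \<le> B"
      using pick[OF remove.prems remove.hyps(2)] by blast
    define A where "A = {w\<in>X. adj u w}"
    define Q where "Q = {w\<in>X. w \<noteq> u \<and> \<not> adj u w \<and> near u w}"
    have fin: "finite A" "finite Q" using \<open>finite X\<close> by (auto simp: A_def Q_def)
    obtain f where f: "good (X - {u}) f" using remove.IH[OF u] remove.prems by blast
    \<comment> \<open>The labels forbidden for \<open>u\<close>. If \<open>f w = 0\<close>,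
      truncation turns \<open>f w - 1\<close> into 0, which is forbidden anyway.\<close>
    define F where "F = (\<Union>w\<in>A. {f w - 1, f w, f w + 1}) \<union> f ` Q"
    have "card (\<Union>w\<in>A. {f w - 1, f w, f w + 1}) \<le> (\<Sum>w\<in>A. 3)"
      using card_UN_le[OF fin(1), of "\<lambda>w. {f w - 1, f w, f w + 1}"]
      by (rule order_trans) (intro sum_mono, simp add: card_insert_if)
    moreover have "card (f ` Q) \<le> card Q" by (rule card_image_le[OF fin(2)])
    moreover have "card F \<le> card (\<Union>w\<in>A. {f w - 1, f w, f w + 1}) + card (f ` Q)"
      unfolding F_def by (rule card_Un_le)
    ultimately have "card F < card {..B}" using le by (simp add: A_def Q_def)
    moreover have "finite F" using fin by (simp add: F_def)
    ultimately obtain c where c: "c \<le> B" "c \<notin> F"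
      by (metis atMost_iff card_mono linorder_not_le subsetI)
    have cA: "c + 2 \<le> f w \<or> f w + 2 \<le> c" if "w \<in> A" for w
    proof -
      have "c \<noteq> f w - 1" "c \<noteq> f w" "c \<noteq> f w + 1" using c(2) that by (auto simp: F_def)
      then show ?thesis by linarith
    qed
    have cQ: "c \<noteq> f w" if "w \<in> Q" for w using c(2) that by (auto simp: F_def)
    have cu: "(adj u w \<longrightarrow> c + 2 \<le> f w \<or> f w + 2 \<le> c) \<and> (near u w \<longrightarrow> c \<noteq> f w)"
      if "w \<in> X" "w \<noteq> u" for w
    proof (cases "adj u w")
      case True
      then show ?thesis using cA[of w] that by (auto simp: A_def)
    next
      case False
      then show ?thesis using cQ[of w] that by (auto simp: Q_def)
    qed
    have "good X (f(u := c))"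
      unfolding good_def
    proof (intro conjI ballI)
      fix v assume "v \<in> X"
      then show "(f(u := c)) v \<le> B" using f c(1) by (auto simp: good_def)
    next
      fix v w assume vw: "v \<in> X" "w \<in> X"
      show "adj v w \<longrightarrow> (f(u := c)) v + 2 \<le> (f(u := c)) w \<or> (f(u := c)) w + 2 \<le> (f(u := c)) v"
        using f cu[of w] cu[of v] vw symm irrefl unfolding good_def
        by (cases "v = u"; cases "w = u") auto
      show "v \<noteq> w \<and> near v w \<longrightarrow> (f(u := c)) v \<noteq> (f(u := c)) w"
        using f cu[of w] cu[of v] vw symm unfolding good_def
        by (cases "v = u"; cases "w = u") auto
    qed
    then show ?case by blast
  qed
  then show ?thesis unfolding good_def by blast
qed

section \<open>Coloured intervals\<close>

lemma finite_obtains_min: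
  fixes f :: "'a \<Rightarrow> 'b :: linorder"
  assumes "finite S" "S \<noteq> {}"
  obtains y where "y \<in> S" "\<And>z. z \<in> S \<Longrightarrow> f y \<le> f z"
proof -
  have "Min (f ` S) \<in> f ` S" using assms by (intro Min_in) auto
  then obtain y where "y \<in> S" "Min (f ` S) = f y" by blast
  then show ?thesis using that assms(1) by (metis Min_le finite_imageI imageI)
qed

lemma finite_obtains_max:
  fixes f :: "'a \<Rightarrow> 'b :: linorder"
  assumes "finite S" "S \<noteq> {}"
  obtains y where "y \<in> S" "\<And>z. z \<in> S \<Longrightarrow> f z \<le> f y"
proof -
  have "Max (f ` S) \<in> f ` S" using assms by (intro Max_in) auto
  then obtain y where "y \<in> S" "Max (f ` S) = f y" by blast
  then show ?thesis using that assms(1) by (metis Max_ge finite_imageI imageI)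
qed

locale coloured_intervals =
  fixes V :: "'a set" and L R :: "'a \<Rightarrow> real" and K :: "'a \<Rightarrow> nat"
  assumes finite_V: "finite V"
    and L_le_R: "v \<in> V \<Longrightarrow> L v \<le> R v"
begin

definition adj :: "'a \<Rightarrow> 'a \<Rightarrow> bool" where
  "adj u v \<longleftrightarrow> L u \<le> R v \<and> L v \<le> R u \<and> K u \<noteq> K v"

definition nbrs :: "'a \<Rightarrow> 'a set" where
  "nbrs v = {u\<in>V. adj v u}"

text \<open>The common neighbours range over all of \<open>V\<close>, so that vertices of a subset \<open>X\<close> which are at
  distance two only through a vertex outside \<open>X\<close> still receive different labels.\<close>

definition near :: "'a \<Rightarrow> 'a \<Rightarrow> bool" where
  "near u v \<longleftrightarrow> nbrs u \<inter> nbrs v \<noteq> {}"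

lemma finite_nbrs: "finite (nbrs v)"
  using finite_V by (simp add: nbrs_def)

lemma adj_commute: "adj u v \<longleftrightarrow> adj v u"
  by (auto simp: adj_def)

section \<open>Vertices that start no later than a given vertex\<close>

definition left_nbrs :: "'a \<Rightarrow> 'a set" where
  "left_nbrs v = {z\<in>nbrs v. L z \<le> L v}"

text \<open>If \<open>v\<close> has the largest left endpoint in \<open>X\<close>, then
  \<open>left_nbrs v\<close> and \<open>left_near v\<close> contain all vertices of \<open>X\<close>
  that constrain the label of \<open>v\<close>.\<close>

definition left_near :: "'a \<Rightarrow> 'a set" where
  "left_near v = {w\<in>V. L w \<le> L v \<and> w \<noteq> v \<and> \<not> adj v w \<and> near v w}"

lemma finite_left: "finite (left_nbrs v)" "finite (left_near v)"
  using finite_V by (simp_all add: left_nbrs_def left_near_def nbrs_def)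

text \<open>If \<open>w\<close> reaches \<open>L v\<close>, it meets \<open>v\<close>, and only
  equal colours prevent adjacency. Otherwise a common neighbour must start by
  \<open>R w < L v\<close>, so it is a left neighbour.\<close>

lemma left_near_cases:
  assumes "v \<in> V" "w \<in> left_near v"
  obtains (contains) "L v \<le> R w" "K w = K v"
  | (left) z where "R w < L v" "z \<in> left_nbrs v" "adj w z" "L z \<le> R w"
proof (cases "L v \<le> R w")
  case True
  then show ?thesis
    using assms L_le_R[of v] contains by (auto simp: left_near_def adj_def)
next
  case False
  obtain z where z: "z \<in> nbrs v" "z \<in> nbrs w"
    using assms(2) by (auto simp: left_near_def near_def)
  then show ?thesis
    using False by (intro left[of z]) (auto simp: left_nbrs_def nbrs_def adj_def)
qed

text \<open>As \<open>L w \<le> L v \<le> R y\<close>, only \<open>L y \<le> R w\<close> is at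
  stake. It is clear if \<open>w\<close> reaches \<open>L v\<close>; otherwise \<open>y\<close>
  starts no later than a left neighbour of \<open>v\<close> that meets \<open>w\<close>.\<close>

lemma left_near_adj_first:
  assumes "v \<in> V" "w \<in> left_near v" "y \<in> left_nbrs v" "K w \<noteq> K y"
    and first: "\<And>z. z \<in> left_nbrs v \<Longrightarrow> K z \<noteq> K w \<Longrightarrow> L y \<le> L z"
  shows "adj w y"
  using assms(1,2)
proof (cases rule: left_near_cases)
  case contains
  then show ?thesis using assms by (auto simp: left_near_def left_nbrs_def nbrs_def adj_def)
next
  case (left z)
  then have "L y \<le> R w" using first[of z] by (force simp: adj_def)
  then show ?thesis using assms(1-4) left by (auto simp: left_near_def left_nbrs_def nbrs_def adj_def)
qed

lemma left_nbrs_colour: "z \<in> left_nbrs v \<Longrightarrow> K z \<noteq> K v"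
  by (auto simp: left_nbrs_def nbrs_def adj_def)

text \<open>Left neighbours of \<open>v\<close> all contain the point \<open>L v\<close>.\<close>

lemma left_nbrs_adj:
  assumes "y \<in> left_nbrs v" "z \<in> left_nbrs v" "K y \<noteq> K z"
  shows "adj y z"
  using assms by (auto simp: left_nbrs_def nbrs_def adj_def)

section \<open>Counting the vertices at distance two on the left\<close>

text \<open>All neighbours start after \<open>v\<close>, so each \<open>w\<close> in
  \<open>left_near v\<close> reaches \<open>L v\<close> and has the colour of \<open>v\<close>. The
  neighbour that starts first is adjacent to all these \<open>w\<close> and to \<open>v\<close>,
  which accounts for the \<open>- 1\<close>.\<close>

lemma card_left_near_no_left_nbrs:
  assumes v: "v \<in> V" and empty: "left_nbrs v = {}"
    and deg: "\<And>u. u \<in> V \<Longrightarrow> card (nbrs u) \<le> D"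
  shows "card (left_near v) \<le> D - 1"
proof (cases "left_near v = {}")
  case True
  then show ?thesis by simp
next
  case False
  then have "nbrs v \<noteq> {}" by (auto simp: left_near_def near_def)
  then obtain y where y: "y \<in> nbrs v" and least: "\<And>z. z \<in> nbrs v \<Longrightarrow> L y \<le> L z"
    using finite_obtains_min[of "nbrs v" L] finite_nbrs[of v] by blast
  have "adj y w" if "w \<in> left_near v" for w
    using v that
  proof (cases rule: left_near_cases)
    case contains
    obtain z where z: "z \<in> nbrs v" "z \<in> nbrs w"
      using \<open>w \<in> left_near v\<close> by (auto simp: left_near_def near_def)
    then have "L y \<le> L z" using least by blast
    moreover have "L v < L y" using empty y by (force simp: left_nbrs_def)
    ultimately show ?thesis
      using \<open>w \<in> left_near v\<close> contains y z L_le_R[of y] by (auto simp: left_near_def nbrs_def adj_def)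
  next
    case (left z)
    then show ?thesis using empty by simp
  qed
  then have "left_near v \<subseteq> nbrs y - {v}" by (auto simp: left_near_def nbrs_def)
  then have "card (left_near v) \<le> card (nbrs y - {v})"
    by (intro card_mono) (auto simp: finite_nbrs)
  also have "\<dots> = card (nbrs y) - 1"
    using v y by (auto simp: nbrs_def adj_commute)
  finally show ?thesis using deg[of y] y by (auto simp: nbrs_def)
qed

text \<open>The single colour of the left neighbours does not occur in \<open>left_near v\<close>: a
  vertex there has the colour of \<open>v\<close> or is adjacent to a left neighbour. So the first
  left neighbour is adjacent to all of \<open>left_near v\<close> and to \<open>v\<close>.\<close>

lemma card_left_near_one_colour:
  assumes v: "v \<in> V" and ne: "left_nbrs v \<noteq> {}"
    and one: "\<And>y z. y \<in> left_nbrs v \<Longrightarrow> z \<in> left_nbrs v \<Longrightarrow> K y = K z"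
    and deg: "\<And>u. u \<in> V \<Longrightarrow> card (nbrs u) \<le> D"
  shows "card (left_near v) \<le> D - 1"
proof -
  obtain y where y: "y \<in> left_nbrs v" and least: "\<And>z. z \<in> left_nbrs v \<Longrightarrow> L y \<le> L z"
    using finite_obtains_min[of "left_nbrs v" L] finite_left(1)[of v] ne by blast
  have "adj y w" if w: "w \<in> left_near v" for w
  proof -
    have "K w \<noteq> K y"
      using v w
    proof (cases rule: left_near_cases)
      case contains
      then show ?thesis using left_nbrs_colour[OF y] by simp
    next
      case (left z)
      then show ?thesis using one[OF y, of z] by (auto simp: adj_def)
    qed
    then show ?thesis using left_near_adj_first[OF v w y] least adj_commute by blast
  qed
  then have "left_near v \<subseteq> nbrs y - {v}" by (auto simp: left_near_def nbrs_def)
  then have "card (left_near v) \<le> card (nbrs y - {v})"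
    by (intro card_mono) (auto simp: finite_nbrs)
  also have "\<dots> = card (nbrs y) - 1"
    using v y by (auto simp: left_nbrs_def nbrs_def adj_commute)
  finally show ?thesis using deg[of y] y by (auto simp: left_nbrs_def nbrs_def)
qed

text \<open>The first left neighbour \<open>y\<close> is adjacent to the part of
  \<open>left_near v\<close> not coloured \<open>K y\<close>, and the first left neighbour
  \<open>y'\<close> of another colour to the rest. Their degrees also count \<open>v\<close> twice
  and each left neighbour at least once, since none shares the colour of both.\<close>

lemma card_left_near_two_colours:
  assumes v: "v \<in> V"
    and two: "y0 \<in> left_nbrs v" "z0 \<in> left_nbrs v" "K y0 \<noteq> K z0"
    and deg: "\<And>u. u \<in> V \<Longrightarrow> card (nbrs u) \<le> D"
  shows "card (left_near v) + card (left_nbrs v) + 2 \<le> 2 * D"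
proof -
  let ?P = "left_nbrs v" and ?Q = "left_near v"
  obtain y where y: "y \<in> ?P" and ymin: "\<And>z. z \<in> ?P \<Longrightarrow> L y \<le> L z"
    using finite_obtains_min[of "?P" L] finite_left(1)[of v] two(1) by blast
  define S where "S = {z\<in>?P. K z \<noteq> K y}"
  have "S \<noteq> {}" using two by (cases "K y0 = K y") (auto simp: S_def)
  moreover have "finite S" using finite_left(1)[of v] by (simp add: S_def)
  ultimately obtain y' where y': "y' \<in> S" and ymin': "\<And>z. z \<in> S \<Longrightarrow> L y' \<le> L z"
    using finite_obtains_min[of "S" L] finite_left(1)[of v] by blast
  then have y'P: "y' \<in> ?P" and col: "K y' \<noteq> K y" by (auto simp: S_def)
  define cls where "cls t = {z\<in>?P. K z = K t}" for t
  \<comment> \<open>\<open>v\<close>, the left neighbours coloured differently from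
    \<open>t\<close>, and \<open>T\<close> are disjoint parts of \<open>nbrs t\<close>.\<close>
  have dom: "1 + (card ?P - card (cls t)) + card T \<le> D"
    if t: "t \<in> ?P" and T: "T \<subseteq> ?Q" "\<And>w. w \<in> T \<Longrightarrow> adj w t" for t T
  proof -
    have fin: "finite T" "finite (?P - cls t)" using T(1) finite_left finite_subset by blast+
    have sub: "insert v (?P - cls t) \<union> T \<subseteq> nbrs t"
    proof -
      have "?P - cls t \<subseteq> nbrs t"
        using left_nbrs_adj[OF t] by (fastforce simp: cls_def left_nbrs_def nbrs_def)
      moreover have "v \<in> nbrs t" using v t adj_commute by (auto simp: left_nbrs_def nbrs_def)
      moreover have "T \<subseteq> nbrs t" using T adj_commute by (auto simp: left_near_def nbrs_def)
      ultimately show ?thesis by blast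
    qed
    have "v \<notin> ?P" by (auto simp: left_nbrs_def nbrs_def adj_def)
    moreover have "insert v (?P - cls t) \<inter> T = {}"
      using T(1) by (auto simp: left_near_def left_nbrs_def nbrs_def)
    ultimately have "card (insert v (?P - cls t) \<union> T) = 1 + card (?P - cls t) + card T"
      using fin by (simp add: card_Un_disjoint)
    moreover have "card (?P - cls t) = card ?P - card (cls t)"
      using finite_left(1) by (intro card_Diff_subset) (auto simp: cls_def)
    moreover have "card (insert v (?P - cls t) \<union> T) \<le> card (nbrs t)"
      by (rule card_mono[OF finite_nbrs sub])
    moreover have "card (nbrs t) \<le> D" using deg t by (auto simp: left_nbrs_def nbrs_def)
    ultimately show ?thesis by linarith
  qed
  define Q1 where "Q1 = {w\<in>?Q. K w \<noteq> K y}"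
  define Q2 where "Q2 = {w\<in>?Q. K w = K y}"
  have 1: "1 + (card ?P - card (cls y)) + card Q1 \<le> D"
    using left_near_adj_first[OF v _ y] ymin by (intro dom[OF y]) (auto simp: Q1_def)
  have 2: "1 + (card ?P - card (cls y')) + card Q2 \<le> D"
    using left_near_adj_first[OF v _ y'P] ymin' col
    by (intro dom[OF y'P]) (auto simp: Q2_def S_def)
  have "Q1 \<union> Q2 = ?Q" by (auto simp: Q1_def Q2_def)
  then have Q: "card ?Q \<le> card Q1 + card Q2" by (metis card_Un_le)
  have "cls y \<inter> cls y' = {}" "cls y \<union> cls y' \<subseteq> ?P" using col by (auto simp: cls_def)
  then have "card (cls y) + card (cls y') \<le> card ?P"
    using finite_left(1)[of v] by (metis card_Un_disjoint card_mono finite_Un finite_subset)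
  with 1 2 Q show ?thesis by linarith
qed

section \<open>A leaf among the left neighbours\<close>

text \<open>Any other such \<open>w\<close> starts by \<open>L v\<close> and reaches
  \<open>L z\<close>, so it meets every left neighbour of \<open>v\<close>. As these have the colour
  of \<open>z\<close>, it would be adjacent to all of them, against \<open>no_twin\<close>.\<close>

lemma last_left_nbr_leaf:
  assumes v: "v \<in> V" and z: "z \<in> left_nbrs v"
    and one: "\<And>y. y \<in> left_nbrs v \<Longrightarrow> K y = K z"
    and last: "\<And>y. y \<in> left_nbrs v \<Longrightarrow> L y \<le> L z"
    and no_twin: "\<And>w. w \<in> V \<Longrightarrow> w \<noteq> v \<Longrightarrow> \<not> left_nbrs v \<subseteq> nbrs w"
    and w: "w \<in> nbrs z" "L w \<le> L v"
  shows "w = v"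
proof (rule ccontr)
  assume "w \<noteq> v"
  moreover have "left_nbrs v \<subseteq> nbrs w"
  proof
    fix y assume y: "y \<in> left_nbrs v"
    then show "y \<in> nbrs w"
      using w one[OF y] last[OF y] by (auto simp: left_nbrs_def nbrs_def adj_def)
  qed
  ultimately show False using no_twin[of w] w(1) by (auto simp: nbrs_def)
qed

text \<open>A common neighbour of \<open>z\<close> and \<open>u\<close> is \<open>v\<close> itself
  or starts after \<open>L v\<close>. In the latter case \<open>u\<close> contains
  \<open>L v\<close>, as \<open>z\<close> does; not being adjacent to \<open>z\<close>, it has the
  colour of \<open>z\<close> and so is adjacent to \<open>v\<close>.\<close>

lemma near_last_left_nbr:
  assumes v: "v \<in> V" and z: "z \<in> left_nbrs v"
    and leaf: "\<And>w. w \<in> nbrs z \<Longrightarrow> L w \<le> L v \<Longrightarrow> w = v"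
    and u: "u \<in> V" "L u \<le> L v" "\<not> adj z u" "near z u"
  shows "u \<in> left_nbrs v"
proof -
  obtain y where y: "y \<in> nbrs z" "y \<in> nbrs u" using u(4) by (auto simp: near_def)
  show ?thesis
  proof (cases "L y \<le> L v")
    case True
    then have "y = v" using leaf y(1) by blast
    then show ?thesis using y(2) u by (auto simp: left_nbrs_def nbrs_def adj_commute)
  next
    case False
    then show ?thesis
      using y u z v L_le_R[of v] by (auto simp: left_nbrs_def nbrs_def adj_def)
  qed
qed

section \<open>Choosing the vertex to be labelled last\<close>

text \<open>The value \<open>D = 1\<close> is excluded because the leaf case may cost
  \<open>D + 2 = 3\<close>, which exceeds \<open>4 * D - 2 = 2\<close>.\<close>

lemma exists_greedy_vertex:
  assumes X: "X \<subseteq> V" "X \<noteq> {}"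
    and deg: "\<And>u. u \<in> V \<Longrightarrow> card (nbrs u) \<le> D"
    and mult: "\<And>u w. u \<in> V \<Longrightarrow> w \<in> V \<Longrightarrow> u \<noteq> w \<Longrightarrow> card (nbrs u \<inter> nbrs w) \<le> M"
    and D: "D \<noteq> 1"
  shows "\<exists>u\<in>X. 3 * card {w\<in>X. adj u w} + card {w\<in>X. w \<noteq> u \<and> \<not> adj u w \<and> near u w}
    \<le> max (4 * D - 2) (D + 3 * M - 1)"
proof -
  have finX: "finite X" using X(1) finite_V finite_subset by blast
  obtain v where vX: "v \<in> X" and vmax: "\<And>u. u \<in> X \<Longrightarrow> L u \<le> L v"
    using finite_obtains_max[of "X" L] finX X(2) by blast
  have v: "v \<in> V" using vX X by blast
  let ?P = "left_nbrs v" and ?Q = "left_near v"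
  let ?A = "{w\<in>X. adj v w}" and ?B = "{w\<in>X. w \<noteq> v \<and> \<not> adj v w \<and> near v w}"
  have AP: "?A \<subseteq> ?P" using X(1) vmax by (auto simp: left_nbrs_def nbrs_def)
  have A: "card ?A \<le> card ?P" by (rule card_mono[OF finite_left(1) AP])
  have "?B \<subseteq> ?Q" using X(1) vmax by (auto simp: left_near_def)
  then have B: "card ?B \<le> card ?Q" by (intro card_mono[OF finite_left(2)])
  have "?P \<subseteq> nbrs v" by (auto simp: left_nbrs_def)
  then have PD: "card ?P \<le> D" using deg[OF v] card_mono[OF finite_nbrs] order_trans by blast
  show ?thesis
  proof (cases "\<exists>y\<in>?P. \<exists>z\<in>?P. K y \<noteq> K z")
    case True
    then have "card ?Q + card ?P + 2 \<le> 2 * D"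
      using card_left_near_two_colours[OF v] deg by blast
    \<comment> \<open>Three times \<open>card ?P\<close> plus \<open>card ?Q\<close> is at most
      \<open>2 * D + (2 * D - 2)\<close>.\<close>
    then show ?thesis using A B PD by (intro bexI[OF _ vX]) linarith
  next
    case one: False
    have Q: "card ?Q \<le> D - 1"
      using card_left_near_no_left_nbrs[OF v] card_left_near_one_colour[OF v] one deg
      by (cases "?P = {}") blast+
    show ?thesis
    \<comment> \<open>As \<open>card ?Q \<le> D - 1\<close>, \<open>v\<close> costs at most
      \<open>3 * M + D - 1\<close> if \<open>card ?A \<le> M\<close>, and at most
      \<open>4 * D - 4\<close> if \<open>card ?A < D\<close>.\<close>
    proof (cases "card ?A \<le> M \<or> card ?A < D \<or> D = 0")
      case True
      then show ?thesis using A B PD Q by (intro bexI[OF _ vX]) linarith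
    next
      case False
      then have big: "M < card ?A" "card ?A = D" "D \<ge> 2" using A PD D by linarith+
      \<comment> \<open>Full degree inside \<open>X\<close> forces every left neighbour into
        \<open>X\<close>, so the leaf \<open>z\<close> chosen below is available.\<close>
      then have P: "?P = ?A" using AP A PD by (metis card_seteq finite_left(1) order.trans)
      have no_twin: "\<not> ?P \<subseteq> nbrs w" if "w \<in> V" "w \<noteq> v" for w
      proof
        assume "?P \<subseteq> nbrs w"
        then have "?P \<subseteq> nbrs v \<inter> nbrs w" by (auto simp: left_nbrs_def)
        then have "card ?P \<le> card (nbrs v \<inter> nbrs w)"
          by (intro card_mono) (auto simp: finite_nbrs)
        then show False using mult[of v w] v that big P by simp
      qed
      have "?P \<noteq> {}" using big P by (metis card.empty not_less_zero)
      then obtain z where z: "z \<in> ?P" and zmax: "\<And>y. y \<in> ?P \<Longrightarrow> L y \<le> L z"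
        using finite_obtains_max[of "?P" L] finite_left(1)[of v] by blast
      have zX: "z \<in> X" using z P by auto
      have leaf: "w = v" if "w \<in> nbrs z" "L w \<le> L v" for w
        using last_left_nbr_leaf[OF v z _ zmax no_twin that] one z by blast
      have "{w\<in>X. adj z w} \<subseteq> {v}" using leaf vmax X(1) by (auto simp: nbrs_def)
      then have "card {w\<in>X. adj z w} \<le> 1" using card_mono[of "{v}"] by fastforce
      moreover have "{w\<in>X. w \<noteq> z \<and> \<not> adj z w \<and> near z w} \<subseteq> ?P - {z}"
        using near_last_left_nbr[OF v z leaf] vmax X(1) by blast
      then have "card {w\<in>X. w \<noteq> z \<and> \<not> adj z w \<and> near z w} \<le> card (?P - {z})"
        by (intro card_mono) (auto simp: finite_left)
      moreover have "card (?P - {z}) = card ?P - 1" using z by simp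
      \<comment> \<open>The leaf costs at most \<open>3 + (D - 1)\<close>, and
        \<open>D + 2 \<le> 4 * D - 2\<close> as \<open>D \<ge> 2\<close>.\<close>
      ultimately show ?thesis using PD big(3) by (intro bexI[OF _ zX]) linarith
    qed
  qed
qed

lemma exists_labelling:
  assumes deg: "\<And>u. u \<in> V \<Longrightarrow> card (nbrs u) \<le> D"
    and mult: "\<And>u w. u \<in> V \<Longrightarrow> w \<in> V \<Longrightarrow> u \<noteq> w \<Longrightarrow> card (nbrs u \<inter> nbrs w) \<le> M"
  shows "\<exists>f. (\<forall>u\<in>V. f u \<le> max (4 * D - 2) (D + 3 * M - 1)) \<and> (\<forall>u\<in>V. \<forall>w\<in>V.
    (adj u w \<longrightarrow> f u + 2 \<le> f w \<or> f w + 2 \<le> f u) \<and> (u \<noteq> w \<and> near u w \<longrightarrow> f u \<noteq> (f w :: nat)))"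
proof (cases "D = 1")
  case False
  show ?thesis
  proof (rule greedy_labelling[OF finite_V])
    show "adj v u" if "adj u v" for u v using that adj_commute by blast
    show "near v u" if "near u v" for u v using that by (auto simp: near_def)
    show "\<not> adj u u" for u by (simp add: adj_def)
  qed (rule exists_greedy_vertex[OF _ _ deg mult False])
next
  case True
  \<comment> \<open>The graph is a matching: the end of larger colour gets 2, all other vertices 0,
    and \<open>4 * D - 2 = 2\<close>.\<close>
  define f :: "'a \<Rightarrow> nat" where "f v = (if \<exists>u\<in>nbrs v. K u < K v then 2 else 0)" for v
  have uniq: "u = w" if "v \<in> V" "u \<in> nbrs v" "w \<in> nbrs v" for u v w
    using deg[OF that(1)] that(2,3) True card_le_Suc0_iff_eq[OF finite_nbrs] by auto
  have edge: "f u = 0 \<and> f w = 2" if "u \<in> V" "w \<in> V" "adj u w" "K u < K w" for u w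
  proof -
    have nb: "w \<in> nbrs u" "u \<in> nbrs w" using that adj_commute[of u w] by (auto simp: nbrs_def)
    have "\<not> K y < K u" if "y \<in> nbrs u" for y
      using uniq[OF \<open>u \<in> V\<close> that nb(1)] \<open>K u < K w\<close> by simp
    then have "f u = 0" by (auto simp: f_def)
    moreover have "f w = 2" using nb(2) \<open>K u < K w\<close> by (auto simp: f_def)
    ultimately show ?thesis ..
  qed
  have "f u + 2 \<le> f w \<or> f w + 2 \<le> f u" if "u \<in> V" "w \<in> V" "adj u w" for u w
    using edge[of u w] edge[of w u] that adj_commute[of u w]
    by (cases "K u < K w") (auto simp: adj_def)
  moreover have "u = w" if "u \<in> V" "w \<in> V" "near u w" for u w
  proof -
    obtain z where "z \<in> nbrs u" "z \<in> nbrs w" using \<open>near u w\<close> by (auto simp: near_def)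
    then show ?thesis using uniq[of z u w] that by (auto simp: nbrs_def adj_commute)
  qed
  moreover have "f u \<le> max (4 * D - 2) (D + 3 * M - 1)" for u using True by (simp add: f_def)
  ultimately show ?thesis by (intro exI[of _ f]) blast
qed

end

section \<open>The bound for interval k-graphs\<close>

lemma (in nomulti_digraph) card_neighbors: "card (neighbors G v) = out_degree G v"
proof -
  have "neighbors G v = head G ` out_arcs G v"
    by (auto simp: neighbors_def arcs_ends_conv out_arcs_def)
  moreover have "inj_on (head G) (out_arcs G v)"
    by (rule inj_onI) (auto intro: no_multi_arcs simp: out_arcs_def arc_to_ends_def)
  ultimately show ?thesis by (simp add: card_image out_degree_def)
qed

lemma (in fin_digraph) out_degree_le_max_degree:
  "v \<in> verts G \<Longrightarrow> out_degree G v \<le> max_degree G"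
  by (simp add: max_degree_def)

lemma (in fin_digraph) finite_codegrees:
  "finite {card (neighbors G u \<inter> neighbors G v) | u v. u \<in> verts G \<and> v \<in> verts G \<and> u \<noteq> v}"
proof (rule finite_subset)
  show "finite ((\<lambda>(u, v). card (neighbors G u \<inter> neighbors G v)) ` (verts G \<times> verts G))"
    by simp
qed auto

lemma (in fin_digraph) card_common_neighbors_le_multiplicity:
  "u \<in> verts G \<Longrightarrow> v \<in> verts G \<Longrightarrow> u \<noteq> v \<Longrightarrow>
    card (neighbors G u \<inter> neighbors G v) \<le> multiplicity G"
  unfolding multiplicity_def using finite_codegrees by (intro Max_ge) auto

lemma (in digraph) multiplicity_le_max_degree: "multiplicity G \<le> max_degree G"
  unfolding multiplicity_def
proof (rule Max.boundedI)
  fix m assume "m \<in> insert 0 {card (neighbors G u \<inter> neighbors G v) | u v.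
    u \<in> verts G \<and> v \<in> verts G \<and> u \<noteq> v}"
  then consider "m = 0" | u v where "u \<in> verts G" "m = card (neighbors G u \<inter> neighbors G v)"
    by blast
  then show "m \<le> max_degree G"
  proof cases
    case (2 u v)
    have "finite (neighbors G u)"
      by (rule finite_subset[of _ "head G ` arcs G"]) (auto simp: neighbors_def arcs_ends_conv)
    then have "m \<le> card (neighbors G u)" using 2 by (auto intro: card_mono)
    then show ?thesis using card_neighbors out_degree_le_max_degree[OF 2(1)] by simp
  qed simp
qed (use finite_codegrees in auto)

lemma (in wf_digraph) graph_dist_2_common_neighbor:
  assumes "graph_dist G u v = 2" "u \<in> verts G"
  shows "u \<noteq> v \<and> (\<exists>w. u \<rightarrow>\<^bsub>G\<^esub> w \<and> w \<rightarrow>\<^bsub>G\<^esub> v)"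
proof -
  have cost: "awalk_cost (\<lambda>_. 1) p = real (length p)" for p :: "'b list"
    by (induction p) auto
  have dist: "\<mu> (\<lambda>_. 1) u v = 2" using assms by (simp add: graph_dist_def)
  have ge: "length p \<ge> 2" if "awalk u p v" for p
    using min_cost_le_walk_cost[OF that, of "\<lambda>_. 1"] dist cost[of p] by simp
  \<comment> \<open>The distance is an infimum of walk costs; a strict upper bound yields an actual
    walk with fewer than 3 arcs, and \<open>ge\<close> excludes fewer than 2.\<close>
  have "\<mu> (\<lambda>_. 1) u v < ereal 3" using dist by simp
  then obtain p where p: "awalk u p v" "length p < 3"
    unfolding \<mu>_def INF_less_iff using cost by auto
  then have "length p = 2" using ge by fastforce
  then obtain a b where ab: "p = [a, b]" by (auto simp: length_Suc_conv numeral_2_eq_2)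
  then have "u \<rightarrow>\<^bsub>G\<^esub> head G a" "head G a \<rightarrow>\<^bsub>G\<^esub> v"
    using p(1) by (auto simp: awalk_simps arcs_ends_conv)
  moreover have "u \<noteq> v" using ge[of "[]"] assms(2) by (auto simp: awalk_Nil_iff)
  ultimately show ?thesis by blast
qed

lemma lambda21_le:
  assumes "finite (verts G)" "verts G \<noteq> {}" "L21_labeling G f" "\<And>v. v \<in> verts G \<Longrightarrow> f v \<le> B"
  shows "lambda21 G \<le> B"
proof -
  have "lambda21 G \<le> label_span G f"
    unfolding lambda21_def using assms(3) by (intro Least_le) blast
  also have "\<dots> \<le> Max (f ` verts G)" by (simp add: label_span_def)
  also have "\<dots> \<le> B" using assms by simp
  finally show ?thesis .
qed

(* Subtraction is on nat. It truncates only for edgeless graphs, where both bounds become 0;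
   over the integers the bounds would be negative there and the claim would be false. *)
theorem corollary5:
  fixes G :: "('a, 'b) pre_digraph" and k :: nat
  assumes "graph G"
    and "verts G \<noteq> {}"
    and "interval_k_graph k G"
  shows "lambda21 G \<le> max (4 * max_degree G - 2) (max_degree G + 3 * multiplicity G - 1) \<and>
    max (4 * max_degree G - 2) (max_degree G + 3 * multiplicity G - 1) \<le> 4 * max_degree G - 1"
proof -
  interpret graph G by fact
  obtain I :: "'a \<Rightarrow> real set" and K :: "'a \<Rightarrow> nat"
    where I: "\<forall>v\<in>verts G. (\<exists>a b. a \<le> b \<and> I v = {a..b}) \<and> K v \<in> {1..k}"
      and edge: "\<forall>u\<in>verts G. \<forall>v\<in>verts G. u \<rightarrow>\<^bsub>G\<^esub> v \<longleftrightarrow> I u \<inter> I v \<noteq> {} \<and> K u \<noteq> K v"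
    using assms(3) unfolding interval_k_graph_def by (elim exE conjE) (rule that)
  have "\<exists>p. fst p \<le> snd p \<and> I v = {fst p..snd p}" if "v \<in> verts G" for v
    using I that by fastforce
  then obtain p where p: "\<And>v. v \<in> verts G \<Longrightarrow> fst (p v) \<le> snd (p v) \<and> I v = {fst (p v)..snd (p v)}"
    by metis
  define L R where "L v = fst (p v)" and "R v = snd (p v)" for v
  have LR: "L v \<le> R v" "I v = {L v..R v}" if "v \<in> verts G" for v
    using p[OF that] by (simp_all add: L_def R_def)
  interpret C: coloured_intervals "verts G" L R K
    using LR by unfold_locales auto
  have adj: "C.adj u v \<longleftrightarrow> u \<rightarrow>\<^bsub>G\<^esub> v" if "u \<in> verts G" "v \<in> verts G" for u v
    using edge that LR[OF that(1)] LR[OF that(2)] by (auto simp: C.adj_def)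
  have nbrs: "C.nbrs v = neighbors G v" if "v \<in> verts G" for v
    using adj[OF that] by (auto simp: C.nbrs_def neighbors_def arcs_ends_conv)
  have "\<exists>f. (\<forall>u\<in>verts G. f u \<le> max (4 * max_degree G - 2) (max_degree G + 3 * multiplicity G - 1))
      \<and> (\<forall>u\<in>verts G. \<forall>w\<in>verts G. (C.adj u w \<longrightarrow> f u + 2 \<le> f w \<or> f w + 2 \<le> f u)
        \<and> (u \<noteq> w \<and> C.near u w \<longrightarrow> f u \<noteq> (f w :: nat)))"
    by (rule C.exists_labelling)
      (simp_all add: nbrs card_neighbors out_degree_le_max_degree
        card_common_neighbors_le_multiplicity)
  then obtain f where
    bound: "\<And>u. u \<in> verts G \<Longrightarrow>
      f u \<le> max (4 * max_degree G - 2) (max_degree G + 3 * multiplicity G - 1)"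
    and sep: "\<And>u w. u \<in> verts G \<Longrightarrow> w \<in> verts G \<Longrightarrow> C.adj u w \<Longrightarrow>
      f u + 2 \<le> f w \<or> f w + 2 \<le> f u"
    and diff: "\<And>u w. u \<in> verts G \<Longrightarrow> w \<in> verts G \<Longrightarrow> u \<noteq> w \<Longrightarrow> C.near u w \<Longrightarrow>
      f u \<noteq> (f w :: nat)"
    by blast
  have "L21_labeling G f"
    unfolding L21_labeling_def
  proof (intro ballI conjI impI)
    fix u v assume uv: "u \<in> verts G" "v \<in> verts G"
    show "2 \<le> \<bar>int (f u) - int (f v)\<bar>" if "u \<rightarrow>\<^bsub>G\<^esub> v"
      using sep[OF uv] adj[OF uv] that by linarith
    show "1 \<le> \<bar>int (f u) - int (f v)\<bar>" if dist: "graph_dist G u v = 2"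
    proof -
      obtain w where "u \<noteq> v" "u \<rightarrow>\<^bsub>G\<^esub> w" "w \<rightarrow>\<^bsub>G\<^esub> v"
        using graph_dist_2_common_neighbor[OF dist uv(1)] by blast
      \<comment> \<open>Symmetry of the arcs reverses the second arc, so the middle vertex is a
        common neighbour.\<close>
      then have "w \<in> neighbors G u \<inter> neighbors G v"
        using arcs_ends_symmetric[OF sym_arcs] by (simp add: neighbors_def)
      then have "f u \<noteq> f v"
        using diff[OF uv \<open>u \<noteq> v\<close>] nbrs uv by (auto simp: C.near_def)
      then show ?thesis by linarith
    qed
  qed
  then have "lambda21 G \<le> max (4 * max_degree G - 2) (max_degree G + 3 * multiplicity G - 1)"
    using bound assms(2) by (intro lambda21_le[of _ f]) auto
  \<comment> \<open>Bounding the multiplicity by the maximum degree turns the second term into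
    \<open>4 * max_degree G - 1\<close>.\<close>
  moreover have "max (4 * max_degree G - 2) (max_degree G + 3 * multiplicity G - 1)
      \<le> 4 * max_degree G - 1"
    using multiplicity_le_max_degree by linarith
  ultimately show ?thesis by blast
qed

end
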